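(* Let $I=[a,b]$ be a compact interval and let $F\in\mathcal{PM}(I,I)$ have forts $c_1<\dots<c_v$ with $v=N(F)>2$, and put $c_0:=a$, $c_{v+1}:=b$. Suppose $H(F)=1$, that the characteristic interval of $F$ is the first lap, $K(F)=[c_0,c_1]$, and that $F$ is strictly increasing on $[c_0,c_1]$. Suppose that the restriction $F|_{[c_0,c_1]}:[c_0,c_1]\to[c_0,c_1]$ is reversing-correspondence and that $$F(c_0)>c_0,\qquad F(c_1)<c_1,\qquad F(c_2)=c_0.$$ Then there exists a continuous function $f:I\to I$ with $f\circ f=F$ on $I$ and $H(f)=2$ such that $f$ is strictly decreasing on $[c_0,c_1]$.
   Context: Let $I=[a,b]$ be a compact interval. A continuous map $F:I\to I$ is a piecewise monotone (PM) function if it has only finitely many forts (non-monotone points), where a fort is a point of $(a,b)$ in no neighbourhood of which $F$ is strictly monotone. If the forts are $c_1<\dots<c_v$, put $c_0:=a$, $c_{v+1}:=b$; then $F$ is strictly monotone on each $[c_i,c_{i+1}]$, $0\le i\le v$, and these subintervals are called the laps of $F$. $\mathcal{PM}(I,I)$ is the set of all PM functions $I\to I$, and $N(F)$ is the number of forts of $F$ (so $N(F)=v$, and $N(F^0)=0$, where $F^0$ is the identity and $F^i$ is the $i$-th iterate). The sequence $N(F^0)\le N(F)\le N(F^2)\le\cdots$ is nondecreasing; the height $H(F)$ is the smallest integer $i\ge 0$ with $N(F^i)=N(F^{i+1})$, and $H(F)=\infty$ if there is none. When $H(F)=1$, there is a lap of $F$ containing the range $F(I)$; this lap is called the characteristic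 interval $K(F)$. (Conversely, existence of a lap covering the range characterizes $H(F)=1$ for maps having forts.) Reversing-correspondence: let $[\alpha,\beta]\subset\mathbb{R}$ be a compact interval and $\phi:[\alpha,\beta]\to[\alpha,\beta]$ a strictly increasing continuous function, with fixed point set $\mathrm{Fix}\,\phi$. Then $\phi$ is called reversing-correspondence if (i) there exist a point $\xi\in\mathrm{Fix}\,\phi$ and a strictly decreasing map $\omega$ of $\mathrm{Fix}\,\phi$ onto itself with $\omega(\xi)=\xi$; (ii) $\alpha$ and $\beta$ either both belong to $\mathrm{Fix}\,\phi$ or both do not; (iii) for every pair of consecutive fixed points $\xi_1<\xi_2\le\xi$ of $\phi$, one has $(\phi(x)-x)(\phi(y)-y)<0$ for all $(x,y)\in(\xi_1,\xi_2)\times(\omega(\xi_2),\omega(\xi_1))$. *)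

theory Defs
  imports "HOL-Analysis.Analysis"
begin

(* A self-map of I = [a,b] is represented by a function on all of real; every notion below
   depends only on its values on {a..b}. *)

definition strictly_monotone_on :: "real set \<Rightarrow> (real \<Rightarrow> real) \<Rightarrow> bool" where
  "strictly_monotone_on S F \<longleftrightarrow> strict_mono_on S F \<or> strict_antimono_on S F"

definition forts :: "real \<Rightarrow> real \<Rightarrow> (real \<Rightarrow> real) \<Rightarrow> real set" where
  "forts a b F = {x \<in> {a<..<b}. \<not> (\<exists>e>0. strictly_monotone_on (ball x e \<inter> {a..b}) F)}"

definition PM :: "real \<Rightarrow> real \<Rightarrow> (real \<Rightarrow> real) set" where
  "PM a b = {F. continuous_on {a..b} F \<and> F \<in> {a..b} \<rightarrow> {a..b} \<and> finite (forts a b F)}"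

(* Only meaningful for members of PM a b: card of an infinite set is 0. *)
definition num_forts :: "real \<Rightarrow> real \<Rightarrow> (real \<Rightarrow> real) \<Rightarrow> nat" where
  "num_forts a b F = card (forts a b F)"

definition height :: "real \<Rightarrow> real \<Rightarrow> (real \<Rightarrow> real) \<Rightarrow> enat" where
  "height a b F =
     (if \<exists>i. num_forts a b (F ^^ i) = num_forts a b (F ^^ Suc i)
      then enat (LEAST i. num_forts a b (F ^^ i) = num_forts a b (F ^^ Suc i))
      else \<infinity>)"

definition laps :: "real \<Rightarrow> real \<Rightarrow> (real \<Rightarrow> real) \<Rightarrow> real set set" where
  "laps a b F =
     {{p..q} | p q. p \<in> insert a (insert b (forts a b F)) \<and> q \<in> insert a (insert b (forts a b F))
                    \<and> p < q \<and> {p<..<q} \<inter> forts a b F = {}}"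

(* A relation rather than a function. If F is in PM a b and has a fort, its range is a
   nondegenerate interval, so at most one lap covers it. *)
definition is_characteristic_interval ::
    "real \<Rightarrow> real \<Rightarrow> (real \<Rightarrow> real) \<Rightarrow> real set \<Rightarrow> bool" where
  "is_characteristic_interval a b F K \<longleftrightarrow> K \<in> laps a b F \<and> F ` {a..b} \<subseteq> K"

definition Fix :: "real \<Rightarrow> real \<Rightarrow> (real \<Rightarrow> real) \<Rightarrow> real set" where
  "Fix \<alpha> \<beta> \<phi> = {x \<in> {\<alpha>..\<beta>}. \<phi> x = x}"

definition consecutive_in :: "real set \<Rightarrow> real \<Rightarrow> real \<Rightarrow> bool" where
  "consecutive_in S x y \<longleftrightarrow> x \<in> S \<and> y \<in> S \<and> x < y \<and> {x<..<y} \<inter> S = {}"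

definition reversing_correspondence :: "real \<Rightarrow> real \<Rightarrow> (real \<Rightarrow> real) \<Rightarrow> bool" where
  "reversing_correspondence \<alpha> \<beta> \<phi> \<longleftrightarrow>
     continuous_on {\<alpha>..\<beta>} \<phi> \<and> \<phi> \<in> {\<alpha>..\<beta>} \<rightarrow> {\<alpha>..\<beta>} \<and> strict_mono_on {\<alpha>..\<beta>} \<phi> \<and>
     (\<alpha> \<in> Fix \<alpha> \<beta> \<phi> \<longleftrightarrow> \<beta> \<in> Fix \<alpha> \<beta> \<phi>) \<and>
     (\<exists>\<xi> \<in> Fix \<alpha> \<beta> \<phi>. \<exists>\<omega>.
        strict_antimono_on (Fix \<alpha> \<beta> \<phi>) \<omega> \<and> \<omega> ` Fix \<alpha> \<beta> \<phi> = Fix \<alpha> \<beta> \<phi> \<and> \<omega> \<xi> = \<xi> \<and>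
        (\<forall>\<xi>1 \<xi>2. consecutive_in (Fix \<alpha> \<beta> \<phi>) \<xi>1 \<xi>2 \<and> \<xi>2 \<le> \<xi> \<longrightarrow>
           (\<forall>x \<in> {\<xi>1<..<\<xi>2}. \<forall>y \<in> {\<omega> \<xi>2<..<\<omega> \<xi>1}. (\<phi> x - x) * (\<phi> y - y) < 0)))"

end

theory Submission
  imports Defs
begin

text \<open>
  On the first lap \<open>F\<close> is extended to a homeomorphism \<open>\<Phi>\<close> of the line with the same fixed
  points. On each gap between fixed points \<open>\<Phi>\<close> is conjugate to a translation, so two gaps on which
  \<open>\<Phi>\<close> moves points in opposite directions are conjugate by a decreasing map. Gluing these maps along
  \<open>\<omega>\<close> gives a decreasing \<open>K\<close> from \<open>(-\<infinity>, \<xi>]\<close> onto \<open>[\<xi>, \<infinity>)\<close> that commutes with \<open>\<Phi>\<close> and can be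
  normalised by \<open>K c\<^sub>0 = c\<^sub>1\<close>; then \<open>g = \<Phi> K\<close> on the left and \<open>g = K\<^sup>-\<^sup>1\<close> on the right of \<open>\<xi>\<close> is a
  decreasing square root with \<open>g c\<^sub>1 = c\<^sub>0\<close>.

  This normalisation lets the root be continued by \<open>f = g\<^sup>-\<^sup>1 F\<close> on \<open>[c\<^sub>1, c\<^sub>2]\<close>, which \<open>f\<close> maps
  increasingly onto \<open>[c\<^sub>0, c\<^sub>1]\<close>, and by \<open>f = (f restricted to [c\<^sub>1, c\<^sub>2])\<^sup>-\<^sup>1 F\<close> on \<open>[c\<^sub>2, b]\<close>. The fort
  \<open>c\<^sub>2\<close> of \<open>F\<close> is not a fort of \<open>f\<close>, whereas \<open>c\<^sub>1\<close> is, and since \<open>f\<close> is injective on the lap containing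
  the range of \<open>F\<close>, \<open>f\<^sup>3\<close> has the forts of \<open>F\<close>; hence the height is 2.
\<close>

section \<open>Monotone surjections of the line and integer iterates of bijections\<close>

lemma strict_mono_surj_continuous:
  fixes f :: "real \<Rightarrow> real"
  assumes "strict_mono f" "surj f"
  shows "continuous_on UNIV f"
  using continuous_onI_mono[of f UNIV] assms by (auto simp: strict_mono_less_eq)

lemma strict_antimono_surj_continuous:
  fixes f :: "real \<Rightarrow> real"
  assumes "strict_antimono_on UNIV f" "surj f"
  shows "continuous_on UNIV f"
proof -
  have "strict_mono (\<lambda>x. - f x)"
    using assms(1) by (auto simp: monotone_on_def)
  moreover have "surj (\<lambda>x. - f x)"
    using assms(2) by (metis add.inverse_inverse surj_def)
  ultimately have "continuous_on UNIV (\<lambda>x. - (- f x))"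
    by (intro continuous_on_minus strict_mono_surj_continuous)
  then show ?thesis by simp
qed

text \<open>Exponents range over all integers so that orbits extend backwards in time. For bijective
  \<open>f\<close> this is the action of the integers generated by \<open>f\<close>.\<close>

definition int_iter :: "('a \<Rightarrow> 'a) \<Rightarrow> int \<Rightarrow> 'a \<Rightarrow> 'a" where
  "int_iter f n = (if n \<ge> 0 then f ^^ nat n else inv f ^^ nat (- n))"

lemma int_iter_0 [simp]: "int_iter f 0 x = x"
  by (simp add: int_iter_def)

lemma int_iter_add_one:
  assumes "bij f"
  shows "int_iter f (n + 1) x = f (int_iter f n x)"
proof (cases "n \<ge> 0")
  case True
  then have "nat (n + 1) = Suc (nat n)" by simp
  with True show ?thesis by (simp add: int_iter_def)
next
  case False
  then have "nat (- n) = Suc (nat (- (n + 1)))" by simp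
  with False assms show ?thesis
    by (cases "n = -1") (auto simp: int_iter_def bij_is_surj surj_f_inv_f)
qed

lemma int_iter_bij:
  assumes "bij f"
  shows "bij (int_iter f n)"
  by (simp add: int_iter_def assms bij_fn bij_imp_bij_inv)

lemma int_iter_commute:
  assumes "bij f"
  shows "int_iter f n (f x) = f (int_iter f n x)"
proof (induction n rule: int_induct[where k = 0])
  case base
  then show ?case by simp
next
  case (step1 i)
  then show ?case by (simp add: int_iter_add_one assms)
next
  case (step2 i)
  have "f (int_iter f (i - 1) (f x)) = f (f (int_iter f (i - 1) x))"
    using step2 int_iter_add_one[OF assms, of "i - 1"] by simp
  then show ?case using assms by (simp add: bij_is_inj inj_eq)
qed

lemma int_iter_fixed:
  assumes "bij f" "f x = x"
  shows "int_iter f n x = x"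
proof (induction n rule: int_induct[where k = 0])
  case base
  then show ?case by simp
next
  case (step1 i)
  then show ?case by (simp add: int_iter_add_one assms)
next
  case (step2 i)
  then have "f (int_iter f (i - 1) x) = f x"
    using int_iter_add_one[OF assms(1), of "i - 1"] assms by simp
  then show ?case using assms by (metis bij_is_inj inj_eq)
qed

lemma int_iter_strict_mono:
  fixes f :: "'a::linorder \<Rightarrow> 'a"
  assumes "strict_mono f" "surj f"
  shows "strict_mono (int_iter f n)"
proof -
  have b: "bij f" using assms by (simp add: bijI strict_mono_imp_inj_on)
  show ?thesis
  proof (induction n rule: int_induct[where k = 0])
    case base
    then show ?case by (simp add: strict_mono_def)
  next
    case (step1 i)
    then show ?case using assms by (simp add: strict_mono_def int_iter_add_one b)
  next
    case (step2 i)
    have "int_iter f i x = f (int_iter f (i - 1) x)" for x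
      using int_iter_add_one[OF b, of "i - 1"] by simp
    with step2 show ?case
      using assms(1) by (simp add: strict_mono_def strict_mono_less[OF assms(1)])
  qed
qed

section \<open>Gaps between fixed points and their parametrization by time\<close>

text \<open>For a non-fixed \<^term>\<open>u\<close>, the component of \<^term>\<open>u\<close> in the complement of the fixed point set.\<close>

definition gap :: "(real \<Rightarrow> real) \<Rightarrow> real \<Rightarrow> real set" where
  "gap \<Phi> u = {x. \<Phi> x \<noteq> x \<and> (\<forall>z. \<Phi> z = z \<longrightarrow> (z < x \<longleftrightarrow> z < u))}"

lemma gap_eq:
  assumes "x \<in> gap \<Phi> u"
  shows "gap \<Phi> x = gap \<Phi> u"
  using assms by (auto simp: gap_def)

text \<open>A continuous increasing map carries the supremum of a set to the supremum of its image.
  For an orbit inside a gap this rules out a bound within the gap.\<close>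

lemma invariant_Sup_fixed:
  fixes f :: "real \<Rightarrow> real"
  assumes "strict_mono f" "surj f" "S \<noteq> {}" "bdd_above S" "f ` S = S"
  shows "f (Sup S) = Sup S"
  using continuous_at_Sup_mono[of f S] strict_mono_surj_continuous[OF assms(1,2)] assms
  by (auto simp: strict_mono_mono continuous_on_eq_continuous_within continuous_at_imp_continuous_at_within)

lemma invariant_Inf_fixed:
  fixes f :: "real \<Rightarrow> real"
  assumes "strict_mono f" "surj f" "S \<noteq> {}" "bdd_below S" "f ` S = S"
  shows "f (Inf S) = Inf S"
  using continuous_at_Inf_mono[of f S] strict_mono_surj_continuous[OF assms(1,2)] assms
  by (auto simp: strict_mono_mono continuous_on_eq_continuous_within continuous_at_imp_continuous_at_within)

text \<open>The interval \<open>[u, \<Phi> u)\<close> is a fundamental domain: its images under the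
  integer iterates tile the gap. Affine interpolation on it, copied to the other tiles by the
  iterates, conjugates translation by one to \<open>\<Phi>\<close>.\<close>

lemma orbit_parametrization_up:
  fixes \<Phi> :: "real \<Rightarrow> real"
  assumes mono: "strict_mono \<Phi>" and surj: "surj \<Phi>" and u: "\<Phi> u > u"
  shows "\<exists>E. strict_mono E \<and> (\<forall>t::real. E (t + 1) = \<Phi> (E t)) \<and> E 0 = u \<and> range E = gap \<Phi> u"
proof -
  have b: "bij \<Phi>" using mono surj by (simp add: bijI strict_mono_imp_inj_on)
  define Z where "Z = int_iter \<Phi>"
  have Zmono: "strict_mono (Z n)" for n
    using int_iter_strict_mono[OF mono surj] by (simp add: Z_def)
  have Zsuc: "Z (n + 1) x = \<Phi> (Z n x)" for n x
    using int_iter_add_one[OF b] by (simp add: Z_def)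
  have Zcomm: "Z n (\<Phi> x) = \<Phi> (Z n x)" for n x
    using int_iter_commute[OF b] by (simp add: Z_def)
  have Zfix: "Z n x = x" if "\<Phi> x = x" for n x
    using int_iter_fixed[OF b that] by (simp add: Z_def)
  have orb_le: "Z m u \<le> Z n u" if "m \<le> n" for m n
    using that
  proof (induction n rule: int_ge_induct)
    case (step i)
    have "Z i u < Z (i + 1) u"
      using Zmono[of i] u by (simp add: Zsuc Zcomm[symmetric] strict_mono_less)
    with step show ?case by simp
  qed simp
  define w where "w t = u + frac t * (\<Phi> u - u)" for t
  have w: "u \<le> w t" "w t < \<Phi> u" for t
  proof -
    show "u \<le> w t" using u by (simp add: w_def)
    have "frac t * (\<Phi> u - u) < 1 * (\<Phi> u - u)"
      using u by (intro mult_strict_right_mono) (auto simp: frac_lt_1)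
    then show "w t < \<Phi> u" by (simp add: w_def)
  qed
  define E where "E t = Z \<lfloor>t\<rfloor> (w t)" for t
  have "strict_mono E"
  proof (rule strict_monoI)
    fix s t :: real assume st: "s < t"
    show "E s < E t"
    proof (cases "\<lfloor>s\<rfloor> = \<lfloor>t\<rfloor>")
      case True
      then have "frac s < frac t" using st by (simp add: frac_def)
      then have "w s < w t" using u by (simp add: w_def)
      with True Zmono show ?thesis by (simp add: E_def strict_mono_less)
    next
      case False
      then have "\<lfloor>s\<rfloor> + 1 \<le> \<lfloor>t\<rfloor>" using st floor_mono[of s t] by linarith
      have "E s < Z \<lfloor>s\<rfloor> (\<Phi> u)" using Zmono w by (simp add: E_def strict_mono_less)
      also have "\<dots> = Z (\<lfloor>s\<rfloor> + 1) u" by (simp add: Zsuc Zcomm)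
      also have "\<dots> \<le> Z \<lfloor>t\<rfloor> u" by (rule orb_le) fact
      also have "\<dots> \<le> E t" using Zmono w by (simp add: E_def strict_mono_less_eq)
      finally show ?thesis .
    qed
  qed
  moreover have "E (t + 1) = \<Phi> (E t)" for t
    by (simp add: E_def w_def frac_def Zsuc)
  moreover have "E 0 = u" by (simp add: E_def w_def Z_def)
  moreover have "range E = gap \<Phi> u"
  proof (intro equalityI subsetI)
    fix x assume "x \<in> range E"
    then obtain t where x: "x = E t" by auto
    have "\<Phi> (w t) \<noteq> w t"
      using w[of t] mono by (metis less_le_not_le strict_mono_less_eq)
    then have "\<Phi> x \<noteq> x"
      using Zmono by (metis E_def Zcomm strict_mono_eq x)
    moreover have "z < x \<longleftrightarrow> z < u" if z: "\<Phi> z = z" for z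
    proof -
      have "z < x \<longleftrightarrow> z < w t"
        using Zmono Zfix[OF z] by (metis E_def strict_mono_less x)
      also have "\<dots> \<longleftrightarrow> z < u"
        using w[of t] z mono by (smt (verit) strict_mono_less_eq)
      finally show ?thesis .
    qed
    ultimately show "x \<in> gap \<Phi> u" by (simp add: gap_def)
  next
    fix x assume x: "x \<in> gap \<Phi> u"
    define S where "S = range (\<lambda>n. Z n u)"
    have "S \<noteq> {}" by (simp add: S_def)
    have inv: "\<Phi> ` S = S"
    proof -
      have "Z n u \<in> \<Phi> ` S" for n
        using Zsuc[of "n - 1" u] by (auto simp: S_def)
      then show ?thesis by (auto simp: S_def Zsuc[symmetric])
    qed
    have uS: "u \<in> S" unfolding S_def by (rule range_eqI[of _ _ 0]) (simp add: Z_def)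
    \<comment> \<open>If \<open>x\<close> lay below the whole orbit, \<open>Inf S\<close> would be a
      fixed point below \<open>u\<close> but not below \<open>x\<close>, which membership in the gap
      excludes.\<close>
    have n0: "\<exists>n. Z n u \<le> x"
    proof (rule ccontr)
      assume "\<not> ?thesis"
      then have *: "\<forall>s\<in>S. x \<le> s" by (auto simp: S_def not_le less_imp_le)
      then have bdd: "bdd_below S" by (meson bdd_belowI)
      then have fixd: "\<Phi> (Inf S) = Inf S"
        using invariant_Inf_fixed[OF mono surj \<open>S \<noteq> {}\<close> _ inv] by simp
      have "x \<le> Inf S" using * \<open>S \<noteq> {}\<close> by (intro cInf_greatest) auto
      moreover have "Inf S \<le> u" using uS bdd by (rule cInf_lower)
      moreover have "Inf S \<noteq> u" using fixd u by auto
      ultimately show False using x fixd by (auto simp: gap_def)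
    qed
    have n1: "\<exists>n. Z n u > x"
    proof (rule ccontr)
      assume "\<not> ?thesis"
      then have *: "\<forall>s\<in>S. s \<le> x" by (auto simp: S_def not_less)
      then have bdd: "bdd_above S" by (meson bdd_aboveI)
      then have fixd: "\<Phi> (Sup S) = Sup S"
        using invariant_Sup_fixed[OF mono surj \<open>S \<noteq> {}\<close> _ inv] by simp
      have "Sup S \<le> x" using * \<open>S \<noteq> {}\<close> by (intro cSup_least) auto
      moreover have "u \<le> Sup S" using uS bdd by (rule cSup_upper)
      moreover have "Sup S \<noteq> x" using fixd x by (auto simp: gap_def)
      ultimately show False using x fixd by (auto simp: gap_def)
    qed
    have "\<exists>n. Z n u \<le> x \<and> x < Z (n + 1) u"
    proof (rule ccontr)
      assume no: "\<not> ?thesis"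
      from n0 obtain n where n: "Z n u \<le> x" by auto
      have "Z m u \<le> x" if "n \<le> m" for m
        using that
      proof (induction m rule: int_ge_induct)
        case base
        then show ?case using n .
      next
        case (step i)
        then show ?case using no by (metis not_le)
      qed
      with n1 orb_le show False by (metis linorder_le_cases not_le order_trans)
    qed
    then obtain n where n: "Z n u \<le> x" "x < Z (n + 1) u" by auto
    obtain y where y: "x = Z n y" using int_iter_bij[OF b, of n] by (metis Z_def bij_pointE)
    have "u \<le> y" "y < \<Phi> u"
      using n Zmono[of n] by (auto simp: y Zsuc Zcomm[symmetric] strict_mono_less_eq strict_mono_less)
    \<comment> \<open>\<open>r\<close> is the time of \<open>y\<close> within the fundamental
      domain, so \<open>n + r\<close> has floor \<open>n\<close> and fractional part
      \<open>r\<close>.\<close>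
    define r where "r = (y - u) / (\<Phi> u - u)"
    have r: "0 \<le> r" "r < 1" using \<open>u \<le> y\<close> \<open>y < \<Phi> u\<close> u by (auto simp: r_def)
    have fl: "\<lfloor>of_int n + r\<rfloor> = n" using r by linarith
    have "frac (of_int n + r) = r" unfolding frac_def fl by simp
    then have "w (of_int n + r) = y" using u by (simp add: w_def r_def)
    with fl have "E (of_int n + r) = x" by (simp add: E_def y)
    then show "x \<in> range E" by blast
  qed
  ultimately show ?thesis by blast
qed

text \<open>Conjugation by \<open>x \<mapsto> - x\<close> turns downward motion into upward motion
  and reduces this to the previous case.\<close>

lemma orbit_parametrization_down:
  fixes \<Phi> :: "real \<Rightarrow> real"
  assumes mono: "strict_mono \<Phi>" and surj: "surj \<Phi>" and u: "\<Phi> u < u"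
  shows "\<exists>E. strict_antimono_on UNIV E \<and> (\<forall>t::real. E (t + 1) = \<Phi> (E t)) \<and> E 0 = u \<and> range E = gap \<Phi> u"
proof -
  define \<Psi> where "\<Psi> x = - \<Phi> (- x)" for x
  have "strict_mono \<Psi>" using mono by (auto simp: \<Psi>_def strict_mono_def)
  moreover have "surj \<Psi>"
    unfolding surj_def \<Psi>_def using surj by (metis add.inverse_inverse surj_def)
  moreover have "\<Psi> (- u) > - u" using u by (simp add: \<Psi>_def)
  ultimately obtain E where E: "strict_mono E" "\<And>t::real. E (t + 1) = \<Psi> (E t)" "E 0 = - u"
      "range E = gap \<Psi> (- u)"
    using orbit_parametrization_up[of \<Psi> "- u"] by blast
  have "gap \<Phi> u = uminus ` gap \<Psi> (- u)"
  proof -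
    have iff: "- x \<in> gap \<Psi> (- u) \<longleftrightarrow> x \<in> gap \<Phi> u" for x
    proof -
      have refl: "(\<forall>z. P z) \<longleftrightarrow> (\<forall>z. P (- z))" for P :: "real \<Rightarrow> bool"
        by (metis add.inverse_inverse)
      \<comment> \<open>Reflection reverses the comparisons with fixed points; since neither
        \<open>x\<close> nor \<open>u\<close> is fixed, the reversed conditions describe the same
        gap.\<close>
      have "- x \<in> gap \<Psi> (- u) \<longleftrightarrow> \<Phi> x \<noteq> x \<and> (\<forall>z. \<Phi> z = z \<longrightarrow> (x < z \<longleftrightarrow> u < z))"
        unfolding gap_def by (subst refl) (auto simp: \<Psi>_def)
      also have "\<dots> \<longleftrightarrow> x \<in> gap \<Phi> u"
        using u unfolding gap_def by (smt (verit) mem_Collect_eq)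
      finally show ?thesis .
    qed
    show ?thesis using iff by (force simp: image_iff)
  qed
  then have "range (\<lambda>t. - E t) = gap \<Phi> u" using E(4) by (metis image_image)
  moreover have "strict_antimono_on UNIV (\<lambda>t. - E t)" using E(1) by (auto simp: monotone_on_def)
  moreover have "- E (t + 1) = \<Phi> (- E t)" for t using E(2) by (simp add: \<Psi>_def)
  moreover have "- E 0 = u" using E(3) by simp
  ultimately show ?thesis by blast
qed

section \<open>Decreasing conjugacies between gaps and their gluing along
  \<open>\<omega>\<close>\<close>

text \<open>In the time parameter \<open>\<Phi>\<close> is \<open>t \<mapsto> t + 1\<close> on both
  gaps, so matching equal times commutes with \<open>\<Phi>\<close>. Opposite directions make
  exactly one parametrization increasing, so the matching is decreasing; time zero gives
  \<open>k u = w\<close>.\<close>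

lemma opposite_gaps_conjugate:
  fixes \<Phi> :: "real \<Rightarrow> real"
  assumes mono: "strict_mono \<Phi>" and surj: "surj \<Phi>" and uw: "(\<Phi> u - u) * (\<Phi> w - w) < 0"
  shows "\<exists>k. strict_antimono_on (gap \<Phi> u) k \<and> (\<forall>x \<in> gap \<Phi> u. k (\<Phi> x) = \<Phi> (k x)) \<and>
           k ` gap \<Phi> u = gap \<Phi> w \<and> k u = w"
proof -
  obtain D E where D: "\<And>t::real. D (t + 1) = \<Phi> (D t)" "D 0 = u" "range D = gap \<Phi> u"
    and E: "\<And>t::real. E (t + 1) = \<Phi> (E t)" "E 0 = w" "range E = gap \<Phi> w"
    and DE: "strict_mono D \<and> strict_antimono_on UNIV E \<or> strict_antimono_on UNIV D \<and> strict_mono E"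
  proof (cases "\<Phi> u > u")
    case True
    then have "\<Phi> w < w" using uw by (simp add: mult_less_0_iff)
    obtain D where "strict_mono D" "\<And>t::real. D (t + 1) = \<Phi> (D t)" "D 0 = u" "range D = gap \<Phi> u"
      using orbit_parametrization_up[OF mono surj True] by blast
    moreover obtain E where "strict_antimono_on UNIV E" "\<And>t::real. E (t + 1) = \<Phi> (E t)" "E 0 = w"
        "range E = gap \<Phi> w"
      using orbit_parametrization_down[OF mono surj \<open>\<Phi> w < w\<close>] by blast
    ultimately show ?thesis using that by blast
  next
    case False
    then have uw': "\<Phi> u < u" "\<Phi> w > w" using uw by (auto simp: mult_less_0_iff)
    obtain D where "strict_antimono_on UNIV D" "\<And>t::real. D (t + 1) = \<Phi> (D t)" "D 0 = u"
        "range D = gap \<Phi> u"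
      using orbit_parametrization_down[OF mono surj uw'(1)] by blast
    moreover obtain E where "strict_mono E" "\<And>t::real. E (t + 1) = \<Phi> (E t)" "E 0 = w"
        "range E = gap \<Phi> w"
      using orbit_parametrization_up[OF mono surj uw'(2)] by blast
    ultimately show ?thesis using that by blast
  qed
  have DE_less: "D s < D t \<longleftrightarrow> E t < E s" for s t
  proof -
    have imp: "D s' < D t' \<and> E t' < E s' \<or> D t' < D s' \<and> E s' < E t'" if "s' < t'" for s' t'
      using DE that by (auto simp: monotone_on_def)
    show ?thesis
      using imp[of s t] imp[of t s] by (cases s t rule: linorder_cases) auto
  qed
  have "inj D"
  proof (rule linorder_injI)
    fix s t :: real assume "s < t"
    with DE show "D s \<noteq> D t" by (auto simp: monotone_on_def) fastforce+
  qed
  define k where "k x = E (inv D x)" for x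
  have kD: "k (D t) = E t" for t using \<open>inj D\<close> by (simp add: k_def)
  have "strict_antimono_on (gap \<Phi> u) k"
    unfolding D(3)[symmetric] by (auto simp: monotone_on_def kD DE_less)
  moreover have "\<forall>x \<in> gap \<Phi> u. k (\<Phi> x) = \<Phi> (k x)"
    unfolding D(3)[symmetric] by (auto simp: kD D(1)[symmetric] E(1)[symmetric])
  moreover have "k ` gap \<Phi> u = gap \<Phi> w"
    unfolding D(3)[symmetric] E(3)[symmetric] by (auto simp: kD image_image)
  moreover have "k u = w" using kD[of 0] D E by simp
  ultimately show ?thesis by blast
qed

text \<open>The neighbours of \<open>u\<close> in the closed set \<open>A\<close> are a supremum and
  an infimum, and monotonicity keeps values of \<open>\<omega>\<close> out of the image gap. It
  serves both for the reversal of the fixed point set and for its inverse.\<close>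

lemma antitone_gap_matching:
  fixes \<omega> :: "real \<Rightarrow> real"
  assumes "closed A" and anti: "strict_antimono_on A \<omega>" and u: "u \<notin> A"
    and lo: "\<exists>z\<in>A. z < u" and hi: "\<exists>z\<in>A. u < z"
  shows "\<exists>s t. consecutive_in A s t \<and> s < u \<and> u < t \<and> {\<omega> t<..<\<omega> s} \<inter> \<omega> ` A = {} \<and> \<omega> t < \<omega> s"
proof -
  define L where "L = A \<inter> {..u}"
  define R where "R = A \<inter> {u..}"
  have L: "L \<noteq> {}" "bdd_above L" "closed L"
    using lo \<open>closed A\<close> by (auto simp: L_def intro: less_imp_le)
  have R: "R \<noteq> {}" "bdd_below R" "closed R"
    using hi \<open>closed A\<close> by (auto simp: R_def intro: less_imp_le)
  have sL: "Sup L \<in> L" using closed_contains_Sup L by blast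
  have tR: "Inf R \<in> R" using closed_contains_Inf R by blast
  have "Sup L < u" "u < Inf R"
    using sL tR u by (auto simp: L_def R_def order_less_le)
  have split: "z \<le> Sup L \<or> Inf R \<le> z" if "z \<in> A" for z
  proof (cases "z \<le> u")
    case True
    then have "z \<in> L" using that by (simp add: L_def)
    then show ?thesis using cSup_upper L by blast
  next
    case False
    then have "z \<in> R" using that by (simp add: R_def)
    then show ?thesis using cInf_lower R by blast
  qed
  have le: "\<omega> z' \<le> \<omega> z" if "z \<in> A" "z' \<in> A" "z \<le> z'" for z z'
    using anti that by (auto simp: monotone_on_def order_le_less)
  have "Sup L \<in> A" "Inf R \<in> A" using sL tR by (auto simp: L_def R_def)
  have "{\<omega> (Inf R)<..<\<omega> (Sup L)} \<inter> \<omega> ` A = {}"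
  proof (rule ccontr)
    assume "\<not> ?thesis"
    then obtain z where z: "z \<in> A" "\<omega> (Inf R) < \<omega> z" "\<omega> z < \<omega> (Sup L)" by auto
    from split[OF z(1)] show False
      using le[OF z(1) \<open>Sup L \<in> A\<close>] le[OF \<open>Inf R \<in> A\<close> z(1)] z by linarith
  qed
  moreover have "consecutive_in A (Sup L) (Inf R)"
    using split \<open>Sup L < u\<close> \<open>u < Inf R\<close> \<open>Sup L \<in> A\<close> \<open>Inf R \<in> A\<close>
    by (fastforce simp: consecutive_in_def)
  moreover have "\<omega> (Inf R) < \<omega> (Sup L)"
    using anti \<open>Sup L < u\<close> \<open>u < Inf R\<close> \<open>Sup L \<in> A\<close> \<open>Inf R \<in> A\<close> by (auto simp: monotone_on_def)
  ultimately show ?thesis using \<open>Sup L < u\<close> \<open>u < Inf R\<close> by blast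
qed

text \<open>\<open>K\<close> is \<open>\<omega>\<close> on the fixed points and, on each gap left of
  \<open>\<xi>\<close>, a conjugacy onto the gap that \<open>\<omega>\<close> assigns to it. The
  points \<open>p\<close> and \<open>q\<close> lie in the two unbounded gaps, which are assigned to
  each other, so \<open>K p = q\<close> can be imposed there.\<close>

lemma decreasing_conjugacy:
  fixes \<Phi> \<omega> :: "real \<Rightarrow> real"
  defines "X \<equiv> {x. \<Phi> x = x}"
  assumes mono: "strict_mono \<Phi>" and surj: "surj \<Phi>"
    and anti: "strict_antimono_on X \<omega>" and onto: "\<omega> ` X = X" and \<xi>: "\<xi> \<in> X" "\<omega> \<xi> = \<xi>"
    and opp: "\<And>s t x y. consecutive_in X s t \<Longrightarrow> t \<le> \<xi> \<Longrightarrow> x \<in> {s<..<t} \<Longrightarrow> y \<in> {\<omega> t<..<\<omega> s}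
      \<Longrightarrow> (\<Phi> x - x) * (\<Phi> y - y) < 0"
    and p: "\<And>x. x \<in> X \<Longrightarrow> p < x" "\<Phi> p > p" and q: "\<And>x. x \<in> X \<Longrightarrow> x < q" "\<Phi> q < q"
  shows "\<exists>K. strict_antimono_on {..\<xi>} K \<and> K ` {..\<xi>} = {\<xi>..} \<and> (\<forall>x\<le>\<xi>. K (\<Phi> x) = \<Phi> (K x)) \<and> K p = q"
proof -
  have "closed X"
    unfolding X_def using strict_mono_surj_continuous[OF mono surj] by (intro closed_Collect_eq) auto
  have gapX: "x \<in> gap \<Phi> u \<longleftrightarrow> x \<notin> X \<and> (\<forall>z\<in>X. z < x \<longleftrightarrow> z < u)" for x u
    by (auto simp: gap_def X_def)
  have less: "\<omega> z < \<omega> w \<longleftrightarrow> w < z" if "z \<in> X" "w \<in> X" for z w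
    using anti that by (metis linorder_neqE_linordered_idom monotone_onD order_less_asym)
  have om: "\<omega> z \<in> X" if "z \<in> X" for z using that onto by blast
  \<comment> \<open>\<open>C u\<close> is the gap right of \<open>\<xi>\<close> assigned to the gap
    of \<open>u\<close>. Describing it by its position among the values of \<open>\<omega>\<close>,
    rather than by end points, covers the unbounded gaps too.\<close>
  define C where "C u = {y. y \<notin> X \<and> (\<forall>z\<in>X. z \<le> \<xi> \<longrightarrow> (z < u \<longleftrightarrow> y < \<omega> z))}" for u
  have CD: "y < \<omega> z \<longleftrightarrow> z < u" "y \<noteq> \<omega> z" if "y \<in> C u" "z \<in> X" "z \<le> \<xi>" for y u z
    using that om[OF that(2)] by (auto simp: C_def)
  have Cgt: "\<xi> < y" if "y \<in> C u" "u < \<xi>" for y u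
    using that \<xi> unfolding C_def by (smt (verit) mem_Collect_eq)
  have C_gap: "C u = gap \<Phi> w" if "w \<in> C u" "u < \<xi>" for u w
  proof -
    have "y \<in> C u \<longleftrightarrow> y \<in> gap \<Phi> w" for y
    proof -
      have w: "w \<notin> X" "\<xi> < w" "\<And>z. z \<in> X \<Longrightarrow> z \<le> \<xi> \<Longrightarrow> z < u \<longleftrightarrow> w < \<omega> z"
        using that Cgt by (auto simp: C_def)
      show ?thesis
      proof
        assume y: "y \<in> C u"
        have "\<omega> z < y \<longleftrightarrow> \<omega> z < w" if z: "z \<in> X" for z
        proof (cases "z \<le> \<xi>")
          case True
          have "\<omega> z \<in> X" using om z by simp
          then have "\<omega> z \<noteq> y" "\<omega> z \<noteq> w" using y w by (auto simp: C_def)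
          then show ?thesis using y w(3)[OF z True] z True by (auto simp: C_def)
        next
          case False
          \<comment> \<open>Fixed points beyond \<open>\<xi>\<close> have images below
            \<open>\<xi>\<close>, hence below both \<open>y\<close> and \<open>w\<close>.\<close>
          then have "\<omega> z < \<xi>" using less[OF z \<xi>(1)] \<xi> by simp
          then show ?thesis using w Cgt[OF y \<open>u < \<xi>\<close>] by simp
        qed
        then have "z < y \<longleftrightarrow> z < w" if "z \<in> X" for z
          using onto that by (metis imageE)
        then show "y \<in> gap \<Phi> w" using y by (simp add: gapX C_def)
      next
        assume y: "y \<in> gap \<Phi> w"
        have "z < u \<longleftrightarrow> y < \<omega> z" if z: "z \<in> X" "z \<le> \<xi>" for z
        proof -
          have "\<omega> z \<in> X" using om z by simp
          then have "\<omega> z \<noteq> y" "\<omega> z \<noteq> w" "\<omega> z < y \<longleftrightarrow> \<omega> z < w" using y w by (auto simp: gapX)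
          then show ?thesis using w(3)[OF z] by auto
        qed
        then show "y \<in> C u" using y by (simp add: gapX C_def)
      qed
    qed
    then show ?thesis by blast
  qed
  have C_eq: "C x = C u" if "x \<in> gap \<Phi> u" for x u
    using that by (auto simp: gapX C_def)
  have pX: "p \<notin> X" and qX: "q \<notin> X" using p q by blast+
  have "p < \<xi>" using p \<xi> by auto
  have qC: "q \<in> C p"
  proof -
    have "\<not> z < p \<and> \<not> q < \<omega> z" if "z \<in> X" for z
      using p(1)[OF that] q(1)[OF om[OF that]] by auto
    then show ?thesis using qX by (auto simp: C_def)
  qed
  define Q where "Q G H k \<longleftrightarrow> strict_antimono_on G k \<and> (\<forall>x\<in>G. k (\<Phi> x) = \<Phi> (k x)) \<and> k ` G = H
      \<and> (p \<in> G \<longrightarrow> k p = q)" for G H k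
  have exQ: "\<exists>k. Q (gap \<Phi> u) (C u) k" if u: "u \<notin> X" "u < \<xi>" for u
  proof (cases "p \<in> gap \<Phi> u")
    case True
    \<comment> \<open>The unbounded gaps have no pair of consecutive fixed points as end points, so
      the opposite signs come from the hypotheses on \<open>p\<close> and \<open>q\<close> instead
      of \<open>opp\<close>.\<close>
    have "(\<Phi> p - p) * (\<Phi> q - q) < 0" using p q by (simp add: mult_pos_neg)
    then have "\<exists>k. Q (gap \<Phi> p) (gap \<Phi> q) k"
      unfolding Q_def using opposite_gaps_conjugate[OF mono surj] by blast
    moreover have "gap \<Phi> p = gap \<Phi> u" using True by (rule gap_eq)
    moreover have "C u = gap \<Phi> q" using C_gap[OF qC \<open>p < \<xi>\<close>] C_eq[OF True] by simp
    ultimately show ?thesis by simp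
  next
    case False
    then have "\<exists>z\<in>X. z < u" using p pX by (force simp: gapX)
    then obtain s t where st: "consecutive_in X s t" "s < u" "u < t"
        "{\<omega> t<..<\<omega> s} \<inter> X = {}" "\<omega> t < \<omega> s"
      using antitone_gap_matching[OF \<open>closed X\<close> anti u(1)] u \<xi> onto by metis
    have stX: "s \<in> X" "t \<in> X" "\<And>z. z \<in> X \<Longrightarrow> z \<le> s \<or> t \<le> z"
      using st by (auto simp: consecutive_in_def not_le)
    have "t \<le> \<xi>" using stX(3)[OF \<xi>(1)] st u by auto
    define w where "w = (\<omega> s + \<omega> t) / 2"
    have w: "w \<in> {\<omega> t<..<\<omega> s}" using st by (simp add: w_def)
    have "(\<Phi> u - u) * (\<Phi> w - w) < 0"
      using opp[OF st(1) \<open>t \<le> \<xi>\<close> _ w] st by simp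
    then have "\<exists>k. Q (gap \<Phi> u) (gap \<Phi> w) k"
      unfolding Q_def using opposite_gaps_conjugate[OF mono surj] False by blast
    moreover have "w \<in> C u"
    proof -
      have "z < u \<longleftrightarrow> w < \<omega> z" if z: "z \<in> X" for z
      proof -
        have "z < u \<longleftrightarrow> z \<le> s" using st stX z by force
        also have "\<dots> \<longleftrightarrow> \<omega> s \<le> \<omega> z" using less[of z s] stX z by (simp add: not_less[symmetric])
        also have "\<dots> \<longleftrightarrow> w < \<omega> z"
        proof -
          have "\<omega> z \<in> X" using om z by simp
          then have "\<omega> z \<notin> {\<omega> t<..<\<omega> s}" using st by blast
          then show ?thesis using w by auto
        qed
        finally show ?thesis .
      qed
      then show ?thesis using w st by (auto simp: C_def)
    qed
    ultimately show ?thesis using C_gap u by auto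
  qed
  \<comment> \<open>The choice depends on \<open>u\<close> only through \<open>gap \<Phi> u\<close>
    and \<open>C u\<close>, so all points of one gap share a single conjugacy.\<close>
  define \<kappa> where "\<kappa> u = (SOME k. Q (gap \<Phi> u) (C u) k)" for u
  have \<kappa>: "Q (gap \<Phi> u) (C u) (\<kappa> u)" if "u \<notin> X" "u < \<xi>" for u
    unfolding \<kappa>_def using exQ[OF that] by (rule someI_ex)
  have \<kappa>_eq: "\<kappa> x = \<kappa> u" if "x \<in> gap \<Phi> u" for x u
    unfolding \<kappa>_def using gap_eq[OF that] C_eq[OF that] by simp
  define K where "K x = (if x \<in> X then \<omega> x else \<kappa> x x)" for x
  have self: "u \<in> gap \<Phi> u" if "u \<notin> X" for u using that by (simp add: gapX)
  have K_gap: "K x = \<kappa> u x" if "x \<in> gap \<Phi> u" for x u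
    using that \<kappa>_eq[OF that] by (auto simp: K_def gapX)
  have K_C: "K x \<in> C x" if "x \<notin> X" "x < \<xi>" for x
    using \<kappa>[OF that] self[OF that(1)] that by (auto simp: Q_def K_def)
  have "strict_antimono_on {..\<xi>} K"
  proof (rule monotone_onI)
    fix x y assume "x \<in> {..\<xi>}" "y \<in> {..\<xi>}" and xy: "x < y"
    then have le: "x \<le> \<xi>" "y \<le> \<xi>" by auto
    \<comment> \<open>A fixed point \<open>z\<close> between \<open>x\<close> and \<open>y\<close>
      separates their images: \<open>K y \<le> \<omega> z \<le> K x\<close>, strictly on at least
      one side.\<close>
    have across: "K y < K x" if z: "z \<in> X" "x \<le> z" "z \<le> y" "z \<le> \<xi>" for z
    proof -
      have x: "\<omega> z \<le> K x \<and> (x < z \<longrightarrow> \<omega> z < K x)"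
      proof (cases "x \<in> X")
        case True
        then show ?thesis using less[OF z(1) True] z by (auto simp: K_def)
      next
        case False
        then have "x < z" using z by (metis order_le_less)
        moreover have "x < \<xi>" using False le \<xi> by (metis order_le_less)
        ultimately have "\<omega> z < K x"
          using CD[OF K_C[OF False] z(1,4)] by linarith
        then show ?thesis by simp
      qed
      have y: "K y \<le> \<omega> z \<and> (z < y \<longrightarrow> K y < \<omega> z)"
      proof (cases "y \<in> X")
        case True
        then show ?thesis using less[OF True z(1)] z by (auto simp: K_def)
      next
        case False
        then have "z < y" using z by (metis order_le_less)
        moreover have "y < \<xi>" using False le \<xi> by (metis order_le_less)
        ultimately have "K y < \<omega> z"
          using CD[OF K_C[OF False] z(1,4)] by simp
        then show ?thesis by simp
      qed
      show ?thesis using x y xy z by (cases "x < z") auto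
    qed
    show "K y < K x"
    proof (cases "\<exists>z\<in>X. x \<le> z \<and> z \<le> y")
      case True
      then show ?thesis using across le by force
    next
      case False
      then have "x \<notin> X" "y \<notin> X" using xy by auto
      then have "y \<in> gap \<Phi> x" using False xy by (fastforce simp: gapX)
      moreover have "x < \<xi>" using xy le by simp
      ultimately show ?thesis
        using \<kappa>[OF \<open>x \<notin> X\<close>] K_gap self[OF \<open>x \<notin> X\<close>] xy by (auto simp: Q_def monotone_on_def)
    qed
  qed
  moreover have "K ` {..\<xi>} = {\<xi>..}"
  proof (intro equalityI subsetI)
    fix y assume "y \<in> K ` {..\<xi>}"
    then obtain x where x: "x \<le> \<xi>" "y = K x" by auto
    show "y \<in> {\<xi>..}"
    proof (cases "x \<in> X")
      case True
      then show ?thesis using x less[OF True \<xi>(1)] \<xi> by (auto simp: K_def not_less[symmetric] less)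
    next
      case False
      then have "x < \<xi>" using x \<xi> by (metis order_le_less)
      then show ?thesis using Cgt[OF K_C[OF False]] x by simp
    qed
  next
    fix y assume "y \<in> {\<xi>..}"
    show "y \<in> K ` {..\<xi>}"
    proof (cases "y \<in> X")
      case True
      then obtain x where x: "x \<in> X" "y = \<omega> x" using onto by auto
      then have "x \<le> \<xi>" using less[OF x(1) \<xi>(1)] \<xi> \<open>y \<in> {\<xi>..}\<close> by (simp add: not_less[symmetric])
      then show ?thesis using x by (auto simp: K_def)
    next
      case False
      then have "\<xi> < y" using \<open>y \<in> {\<xi>..}\<close> \<xi> by (auto simp: order_less_le)
      \<comment> \<open>A bounded gap is traced back through the inverse \<open>\<eta>\<close> of
        \<open>\<omega>\<close>, taking a midpoint for \<open>u\<close>; if no fixed point lies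
        above \<open>y\<close>, then \<open>y\<close> is in the gap of \<open>q\<close> and
        \<open>u = p\<close> works.\<close>
      obtain u where u: "u \<notin> X" "u < \<xi>" "y \<in> C u"
      proof (cases "\<exists>z\<in>X. y < z")
        case True
        define \<eta> where "\<eta> = inv_into X \<omega>"
        have "inj_on \<omega> X" using less by (metis inj_onI linorder_neqE_linordered_idom order_less_irrefl)
        then have \<eta>: "\<eta> (\<omega> z) = z" if "z \<in> X" for z using that by (simp add: \<eta>_def)
        have "strict_antimono_on X \<eta>"
        proof (rule monotone_onI)
          fix v w assume "v \<in> X" "w \<in> X" and vw: "v < w"
          then obtain v' w' where v': "v' \<in> X" "w' \<in> X" "v = \<omega> v'" "w = \<omega> w'"
            using onto by (metis imageE)
          then show "\<eta> w < \<eta> v" using vw \<eta> less by simp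
        qed
        moreover have "\<eta> ` X = X"
        proof -
          have "\<eta> ` X = \<eta> ` \<omega> ` X" using onto by simp
          also have "\<dots> = (\<lambda>z. z) ` X" unfolding image_image using \<eta> by (intro image_cong) auto
          finally show ?thesis by simp
        qed
        ultimately obtain s t where st: "consecutive_in X s t" "s < y" "y < t"
            "{\<eta> t<..<\<eta> s} \<inter> X = {}" "\<eta> t < \<eta> s"
          using antitone_gap_matching[OF \<open>closed X\<close> _ False] \<open>\<xi> < y\<close> \<xi>(1) True by metis
        have stX: "s \<in> X" "t \<in> X" "\<And>z. z \<in> X \<Longrightarrow> z \<le> s \<or> t \<le> z"
          using st by (auto simp: consecutive_in_def not_le)
        have om': "\<omega> (\<eta> z) = z" "\<eta> z \<in> X" if "z \<in> X" for z
          using that onto by (auto simp: \<eta>_def f_inv_into_f inv_into_into)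
        define u where "u = (\<eta> s + \<eta> t) / 2"
        have u: "u \<in> {\<eta> t<..<\<eta> s}" using st by (simp add: u_def)
        have "\<xi> \<le> s" using stX(3)[OF \<xi>(1)] st \<open>\<xi> < y\<close> by auto
        then have "\<eta> s \<le> \<xi>" using less[OF om'(2)[OF stX(1)] \<xi>(1)] om'(1)[OF stX(1)] \<xi> by (metis not_le)
        have "z < u \<longleftrightarrow> y < \<omega> z" if z: "z \<in> X" for z
        proof -
          have "\<omega> z \<in> X" using om z by simp
          have "y < \<omega> z \<longleftrightarrow> t \<le> \<omega> z" using st stX(3)[OF \<open>\<omega> z \<in> X\<close>] by force
          also have "\<dots> \<longleftrightarrow> z \<le> \<eta> t"
            using less[OF z om'(2)[OF stX(2)]] om'(1)[OF stX(2)] by (metis not_le)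
          also have "\<dots> \<longleftrightarrow> z < u"
          proof -
            have "z \<notin> {\<eta> t<..<\<eta> s}" using st(4) z by blast
            then show ?thesis using u by auto
          qed
          finally show ?thesis by simp
        qed
        then have "y \<in> C u" using False by (simp add: C_def)
        moreover have "u \<notin> X" using u st by blast
        moreover have "u < \<xi>" using u \<open>\<eta> s \<le> \<xi>\<close> by auto
        ultimately show ?thesis using that by blast
      next
        case no: False
        then have "z < y" if "z \<in> X" for z using that False by (metis linorder_neqE_linordered_idom)
        then have "y \<in> gap \<Phi> q" using q(1) False by (simp add: gapX)
        then have "y \<in> C p" using C_gap[OF qC \<open>p < \<xi>\<close>] by simp
        then show ?thesis using that pX \<open>p < \<xi>\<close> by blast
      qed
      then obtain x where x: "x \<in> gap \<Phi> u" "y = \<kappa> u x" using \<kappa>[OF u(1,2)] by (auto simp: Q_def)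
      then have "x \<noteq> \<xi>" "\<not> \<xi> < x" using u \<xi> by (auto simp: gapX)
      then have "x \<le> \<xi>" by simp
      then show ?thesis using x K_gap by (force simp: image_iff)
    qed
  qed
  moreover have "K (\<Phi> x) = \<Phi> (K x)" if "x \<le> \<xi>" for x
  proof (cases "x \<in> X")
    case True
    moreover have "\<omega> x \<in> X" using True om by simp
    ultimately show ?thesis by (simp add: K_def) (simp add: X_def)
  next
    case False
    then have "x < \<xi>" using that \<xi> by (metis order_le_less)
    have "\<Phi> x \<in> gap \<Phi> x"
      unfolding gap_def using mono False unfolding X_def
      by (smt (verit) mem_Collect_eq strict_mono_eq strict_mono_less)
    then show ?thesis
      using \<kappa>[OF False \<open>x < \<xi>\<close>] K_gap self[OF False] by (simp add: Q_def)
  qed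
  moreover have "K p = q"
    using \<kappa>[OF pX \<open>p < \<xi>\<close>] K_gap[OF self[OF pX]] self[OF pX] by (simp add: Q_def)
  ultimately show ?thesis by blast
qed

section \<open>The decreasing square root on the first lap\<close>

text \<open>With \<open>\<Phi> K\<close> on the left and the inverse of \<open>K\<close> on the
  right of \<open>\<xi>\<close>, a point changes side under \<open>g\<close>, so each two-step orbit
  uses both formulas. Commutation of \<open>K\<close> with \<open>\<Phi>\<close> makes the result
  \<open>\<Phi>\<close> from either side.\<close>

lemma decreasing_square_root:
  fixes \<Phi> K :: "real \<Rightarrow> real"
  assumes mono: "strict_mono \<Phi>" and surj: "surj \<Phi>" and \<xi>: "\<Phi> \<xi> = \<xi>"
    and anti: "strict_antimono_on {..\<xi>} K" and onto: "K ` {..\<xi>} = {\<xi>..}"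
    and comm: "\<And>x. x \<le> \<xi> \<Longrightarrow> K (\<Phi> x) = \<Phi> (K x)"
  shows "\<exists>g. strict_antimono_on UNIV g \<and> (\<forall>x. g (g x) = \<Phi> x) \<and> (\<forall>x\<le>\<xi>. g (K x) = x)"
proof -
  define L where "L = inv_into {..\<xi>} K"
  have less: "K x < K y \<longleftrightarrow> y < x" if "x \<le> \<xi>" "y \<le> \<xi>" for x y
    using anti that by (metis atMost_iff linorder_neqE_linordered_idom monotone_onD order_less_asym)
  then have inj: "inj_on K {..\<xi>}"
    by (metis atMost_iff inj_onI linorder_neqE_linordered_idom order_less_irrefl)
  have LK: "L (K x) = x" if "x \<le> \<xi>" for x using inj that by (simp add: L_def)
  have K_ge: "\<xi> \<le> K x" if "x \<le> \<xi>" for x using onto that by auto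
  have ex: "\<exists>x\<le>\<xi>. y = K x" if "\<xi> \<le> y" for y using onto that by auto
  have K\<xi>: "K \<xi> = \<xi>"
  proof -
    obtain x where x: "x \<le> \<xi>" "\<xi> = K x" using ex by blast
    then have "\<not> x < \<xi>" using less[of \<xi> x] K_ge[of \<xi>] by auto
    then show ?thesis using x by auto
  qed
  have \<Phi>_le: "\<Phi> x \<le> \<xi> \<longleftrightarrow> x \<le> \<xi>" for x using mono \<xi> by (metis strict_mono_less_eq)
  define g where "g x = (if x \<le> \<xi> then \<Phi> (K x) else L x)" for x
  have gK: "g (K x) = x" if x: "x \<le> \<xi>" for x
  proof (cases "K x = \<xi>")
    case True
    then have "x = \<xi>" using LK[OF x] LK[of \<xi>] K\<xi> by simp
    then show ?thesis by (simp add: g_def K\<xi> \<xi>)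
  next
    case False
    then show ?thesis using K_ge[OF x] LK[OF x] by (simp add: g_def)
  qed
  have "g (g x) = \<Phi> x" for x
  proof (cases "x \<le> \<xi>")
    case True
    then have "g x = K (\<Phi> x)" by (simp add: g_def comm)
    then show ?thesis using gK True \<Phi>_le by simp
  next
    case False
    then obtain w where w: "w \<le> \<xi>" "x = K w" using ex by (metis less_imp_le not_le)
    then show ?thesis using gK by (simp add: g_def comm)
  qed
  moreover have "strict_antimono_on UNIV g"
  proof (rule monotone_onI)
    have left: "g y < g x" if "x < y" "y \<le> \<xi>" for x y
      using that less[of y x] mono by (simp add: g_def strict_mono_less)
    have right: "g y < g x" if xy: "x < y" "\<xi> \<le> x" for x y
    proof -
      obtain v w where vw: "v \<le> \<xi>" "w \<le> \<xi>" "x = K v" "y = K w"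
        using ex xy by (metis less_imp_le order_trans)
      then show ?thesis using xy less by (simp add: gK)
    qed
    fix x y :: real assume "x < y"
    then show "g y < g x"
      using left[of x y] right[of x y] left[of x \<xi>] right[of \<xi> y] by fastforce
  qed
  ultimately show ?thesis using gK by blast
qed

text \<open>Both end points move inward, so \<open>\<alpha>\<close> and \<open>\<beta>\<close> lie
  outside all fixed points and can serve as the normalised pair \<open>p\<close>, \<open>q\<close>.
  Making \<open>g\<close> a bijection of the whole line lets its inverse be used without domain
  conditions.\<close>

lemma reversing_correspondence_decreasing_root:
  assumes "\<alpha> < \<beta>" and rc: "reversing_correspondence \<alpha> \<beta> \<phi>" and "\<phi> \<alpha> > \<alpha>" "\<phi> \<beta> < \<beta>"
  shows "\<exists>g. strict_antimono_on UNIV g \<and> surj g \<and> (\<forall>x\<in>{\<alpha>..\<beta>}. g (g x) = \<phi> x) \<and> g \<beta> = \<alpha>"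
proof -
  have cont: "continuous_on {\<alpha>..\<beta>} \<phi>" and mono: "strict_mono_on {\<alpha>..\<beta>} \<phi>"
    using rc by (auto simp: reversing_correspondence_def)
  obtain \<xi> \<omega> where \<xi>: "\<xi> \<in> Fix \<alpha> \<beta> \<phi>" "\<omega> \<xi> = \<xi>"
    and \<omega>: "strict_antimono_on (Fix \<alpha> \<beta> \<phi>) \<omega>" "\<omega> ` Fix \<alpha> \<beta> \<phi> = Fix \<alpha> \<beta> \<phi>"
    and opp: "\<And>s t x y. consecutive_in (Fix \<alpha> \<beta> \<phi>) s t \<Longrightarrow> t \<le> \<xi> \<Longrightarrow> x \<in> {s<..<t} \<Longrightarrow> y \<in> {\<omega> t<..<\<omega> s}
      \<Longrightarrow> (\<phi> x - x) * (\<phi> y - y) < 0"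
    using rc unfolding reversing_correspondence_def by blast
  text \<open>Extending by translations creates no new fixed points.\<close>
  define \<Phi> where "\<Phi> x = (if x < \<alpha> then x + (\<phi> \<alpha> - \<alpha>) else if x \<le> \<beta> then \<phi> x else x + (\<phi> \<beta> - \<beta>))" for x
  have \<Phi>_eq: "\<Phi> x = \<phi> x" if "x \<in> {\<alpha>..\<beta>}" for x using that by (simp add: \<Phi>_def)
  have X: "{x. \<Phi> x = x} = Fix \<alpha> \<beta> \<phi>"
    using assms by (auto simp: \<Phi>_def Fix_def split: if_splits)
  have le: "\<phi> \<alpha> \<le> \<phi> x" "\<phi> x \<le> \<phi> \<beta>" if "x \<in> {\<alpha>..\<beta>}" for x
    using mono that \<open>\<alpha> < \<beta>\<close> by (auto simp: strict_mono_on_leD)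
  have "strict_mono \<Phi>"
  proof (rule strict_monoI)
    fix x y :: real assume "x < y"
    then show "\<Phi> x < \<Phi> y"
      using le[of x] le[of y] le[of \<alpha>] \<open>\<alpha> < \<beta>\<close> strict_mono_onD[OF mono, of x y]
      by (auto simp: \<Phi>_def)
  qed
  moreover have "surj \<Phi>"
  proof -
    have "\<exists>x. \<Phi> x = y" for y
    proof -
      consider "y < \<phi> \<alpha>" | "\<phi> \<alpha> \<le> y" "y \<le> \<phi> \<beta>" | "\<phi> \<beta> < y" by linarith
      then show ?thesis
      proof cases
        case 1
        then have "\<Phi> (y - (\<phi> \<alpha> - \<alpha>)) = y" by (simp add: \<Phi>_def)
        then show ?thesis ..
      next
        case 2
        then obtain x where "\<alpha> \<le> x" "x \<le> \<beta>" "\<phi> x = y"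
          using IVT'[of \<phi> \<alpha> y \<beta>] cont \<open>\<alpha> < \<beta>\<close> by auto
        then have "\<Phi> x = y" by (simp add: \<Phi>_def)
        then show ?thesis ..
      next
        case 3
        then have "\<Phi> (y - (\<phi> \<beta> - \<beta>)) = y" using \<open>\<alpha> < \<beta>\<close> by (simp add: \<Phi>_def)
        then show ?thesis ..
      qed
    qed
    then show ?thesis by (metis surjI)
  qed
  moreover have "(\<Phi> x - x) * (\<Phi> y - y) < 0"
    if st: "consecutive_in (Fix \<alpha> \<beta> \<phi>) s t" "t \<le> \<xi>" and xy: "x \<in> {s<..<t}" "y \<in> {\<omega> t<..<\<omega> s}" for s t x y
  proof -
    have "s \<in> Fix \<alpha> \<beta> \<phi>" "t \<in> Fix \<alpha> \<beta> \<phi>" using st by (auto simp: consecutive_in_def)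
    moreover have "\<omega> s \<in> Fix \<alpha> \<beta> \<phi>" "\<omega> t \<in> Fix \<alpha> \<beta> \<phi>" using calculation \<omega>(2) by blast+
    ultimately have "x \<in> {\<alpha>..\<beta>}" "y \<in> {\<alpha>..\<beta>}" using xy by (auto simp: Fix_def)
    then show ?thesis using opp[OF st xy] \<Phi>_eq by simp
  qed
  moreover have "\<alpha> < x" "x < \<beta>" if "x \<in> Fix \<alpha> \<beta> \<phi>" for x
    using that assms by (auto simp: Fix_def order_le_less)
  moreover have "\<Phi> \<alpha> > \<alpha>" "\<Phi> \<beta> < \<beta>" using assms by (auto simp: \<Phi>_def)
  ultimately obtain K where K: "strict_antimono_on {..\<xi>} K" "K ` {..\<xi>} = {\<xi>..}"
      "\<And>x. x \<le> \<xi> \<Longrightarrow> K (\<Phi> x) = \<Phi> (K x)" "K \<alpha> = \<beta>"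
    using decreasing_conjugacy[of \<Phi> \<omega> \<xi> \<alpha> \<beta>] \<xi> \<omega> unfolding X by blast
  have "\<Phi> \<xi> = \<xi>" "\<alpha> \<le> \<xi>" using X \<xi> by (auto simp: Fix_def)
  then obtain g where g: "strict_antimono_on UNIV g" "\<And>x. g (g x) = \<Phi> x" "\<And>x. x \<le> \<xi> \<Longrightarrow> g (K x) = x"
    using decreasing_square_root[OF \<open>strict_mono \<Phi>\<close> \<open>surj \<Phi>\<close> _ K(1-3)] by blast
  have "surj g" using g(2) \<open>surj \<Phi>\<close> by (metis surj_def)
  moreover have "g \<beta> = \<alpha>" using g(3)[OF \<open>\<alpha> \<le> \<xi>\<close>] K(4) by simp
  ultimately show ?thesis using g \<Phi>_eq by auto
qed

section \<open>Forts and local injectivity\<close>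

lemma forts_cong:
  assumes "\<And>x. x \<in> {a..b} \<Longrightarrow> F x = G x"
  shows "forts a b F = forts a b G"
proof -
  have "strictly_monotone_on (S \<inter> {a..b}) F \<longleftrightarrow> strictly_monotone_on (S \<inter> {a..b}) G" for S
    using assms by (auto simp: strictly_monotone_on_def monotone_on_def)
  then show ?thesis by (simp add: forts_def)
qed

text \<open>On an interval a continuous map is strictly monotone exactly if it is injective.
  Injectivity passes through compositions such as \<open>f (f x) = F x\<close> without tracking
  directions.\<close>

lemma fort_iff_not_locally_injective:
  assumes "continuous_on {a..b} F"
  shows "x \<in> forts a b F \<longleftrightarrow> x \<in> {a<..<b} \<and> \<not> (\<exists>e>0. inj_on F (ball x e \<inter> {a..b}))"
proof -
  have "strictly_monotone_on (ball x e \<inter> {a..b}) F \<longleftrightarrow> inj_on F (ball x e \<inter> {a..b})" for e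
    unfolding strictly_monotone_on_def
  proof (rule injective_eq_monotone_map[symmetric])
    show "is_interval (ball x e \<inter> {a..b})"
      by (intro is_interval_Int) (auto simp: is_interval_convex_1)
    show "continuous_on (ball x e \<inter> {a..b}) F"
      using assms by (rule continuous_on_subset) auto
  qed
  then show ?thesis by (simp add: forts_def)
qed

text \<open>Equal values at two points force an extremum strictly between them, and near an interior
  extremum the map is not strictly monotone.\<close>

lemma inj_on_lap:
  assumes cont: "continuous_on {a..b} F" and "a \<le> p" "q \<le> b"
    and no: "{p<..<q} \<inter> forts a b F = {}"
  shows "inj_on F {p..q}"
proof (rule linorder_inj_onI')
  fix x y assume xy: "x \<in> {p..q}" "y \<in> {p..q}" "x < y"
  show "F x \<noteq> F y"
  proof
    assume eq: "F x = F y"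
    have cont': "continuous_on {x..y} F"
      using cont by (rule continuous_on_subset) (use xy assms in auto)
    obtain s where s: "s \<in> {x..y}" "\<And>w. w \<in> {x..y} \<Longrightarrow> F w \<le> F s"
      using continuous_attains_sup[OF _ _ cont'] xy by auto
    obtain t where t: "t \<in> {x..y}" "\<And>w. w \<in> {x..y} \<Longrightarrow> F t \<le> F w"
      using continuous_attains_inf[OF _ _ cont'] xy by auto
    obtain z where z: "x < z" "z < y" "(\<forall>w\<in>{x..y}. F w \<le> F z) \<or> (\<forall>w\<in>{x..y}. F z \<le> F w)"
    proof (cases "s \<in> {x<..<y} \<or> t \<in> {x<..<y}")
      case True
      then show ?thesis using s t that[of s] that[of t] by auto
    next
      case False
      then have "s = x \<or> s = y" "t = x \<or> t = y" using s(1) t(1) by auto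
      \<comment> \<open>With both extrema attained only at the ends, where the values agree, the map
        is constant and the midpoint is an extremum.\<close>
      then have "F s = F x" "F t = F x" using eq by auto
      then have const: "F w = F x" if "w \<in> {x..y}" for w using s(2)[OF that] t(2)[OF that] by linarith
      have "F w \<le> F ((x + y) / 2)" if "w \<in> {x..y}" for w
        using const[OF that] const[of "(x + y) / 2"] \<open>x < y\<close> by simp
      then show ?thesis using that[of "(x + y) / 2"] \<open>x < y\<close> by simp
    qed
    have "z \<in> {p<..<q}" using z xy by auto
    then have "z \<notin> forts a b F" using no by blast
    then obtain e where e: "e > 0" "strictly_monotone_on (ball z e \<inter> {a..b}) F"
      using z xy assms by (auto simp: forts_def)
    define d where "d = min e (min (z - x) (y - z)) / 2"
    have d: "0 < d" "d < e" "d < z - x" "d < y - z" using z e by (auto simp: d_def min_def)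
    have "{z - d, z, z + d} \<subseteq> ball z e \<inter> {a..b}" using d xy assms by (auto simp: dist_real_def)
    then have "F (z - d) < F z \<and> F z < F (z + d) \<or> F (z + d) < F z \<and> F z < F (z - d)"
      using e(2) d(1) by (auto simp: strictly_monotone_on_def monotone_on_def)
    moreover have "z - d \<in> {x..y}" "z + d \<in> {x..y}" using d by auto
    ultimately show False using z(3) by (metis leD)
  qed
qed

section \<open>Continuation of the root over the remaining laps, and its height\<close>

theorem theorem2p3:
  fixes a b :: real and F :: "real \<Rightarrow> real" and v :: nat and c :: "nat \<Rightarrow> real"
  assumes "a < b"
    and "F \<in> PM a b"
    and "v = num_forts a b F" and "v > 2"
    and "c 0 = a" and "c (Suc v) = b" and "c ` {1..v} = forts a b F"
    and "strict_mono_on {0..Suc v} c"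
    and "height a b F = 1"
    and "is_characteristic_interval a b F {c 0..c 1}"
    and "strict_mono_on {c 0..c 1} F"
    and "reversing_correspondence (c 0) (c 1) F"
    and "F (c 0) > c 0" and "F (c 1) < c 1" and "F (c 2) = c 0"
  shows "\<exists>f \<in> PM a b. (\<forall>x \<in> {a..b}. f (f x) = F x) \<and> height a b f = 2
           \<and> strict_antimono_on {c 0..c 1} f"
proof -
  have cont: "continuous_on {a..b} F" and fin: "finite (forts a b F)"
    using \<open>F \<in> PM a b\<close> by (auto simp: PM_def)
  have c_less: "c i < c j" if "i < j" "j \<le> Suc v" for i j
    using \<open>strict_mono_on {0..Suc v} c\<close> that by (auto simp: monotone_on_def)
  have order: "a < c 1" "c 1 < c 2" "c 2 < c 3" "c 3 \<le> b"
    using c_less[of 0 1] c_less[of 1 2] c_less[of 2 3] c_less[of 3 "Suc v"] assms(4-6)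
    by (auto simp: order_le_less)
  have lap: "inj_on F {c i..c (Suc i)}" if "i \<le> v" for i
  proof (rule inj_on_lap[OF cont])
    show "a \<le> c i" using c_less[of 0 i] that \<open>c 0 = a\<close> by (cases "i = 0") auto
    show "c (Suc i) \<le> b" using c_less[of "Suc i" "Suc v"] that \<open>c (Suc v) = b\<close> by (cases "i = v") auto
    have "c j \<le> c i \<or> c (Suc i) \<le> c j" if "j \<in> {1..v}" for j
      using c_less[of j i] c_less[of "Suc i" j] that \<open>i \<le> v\<close>
      by (cases j i rule: linorder_cases; cases "j = Suc i") auto
    then show "{c i<..<c (Suc i)} \<inter> forts a b F = {}"
      unfolding assms(7)[symmetric] by force
  qed
  have inj: "inj_on F {c 1..c 2}" "inj_on F {c 2..c 3}"
    using lap[of 1] lap[of 2] \<open>v > 2\<close> by (auto simp: numeral_2_eq_2 numeral_3_eq_3)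
  have forts: "c 1 \<in> forts a b F" "c 2 \<in> forts a b F"
    using assms(4) unfolding assms(7)[symmetric] by auto
  have "F ` {a..b} \<subseteq> {a..c 1}"
    using assms(5,10) by (simp add: is_characteristic_interval_def)
  then have F_range: "F x \<in> {a..c 1}" if "x \<in> {a..b}" for x
    using that by blast
  have F_mono: "F x \<le> F y" if "a \<le> x" "x \<le> y" "y \<le> c 1" for x y
    using assms(5,11) that by (auto simp: strict_mono_on_leD)

  obtain g where g: "strict_antimono_on UNIV g" "surj g" "\<And>x. x \<in> {a..c 1} \<Longrightarrow> g (g x) = F x" "g (c 1) = a"
    using reversing_correspondence_decreasing_root[of "c 0" "c 1" F] assms order by auto
  have g_less: "g x < g y \<longleftrightarrow> y < x" for x y
    using g(1) by (metis UNIV_I linorder_neqE_linordered_idom monotone_onD order_less_asym)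
  have g_le: "g x \<le> g y \<longleftrightarrow> y \<le> x" for x y using g_less by (metis not_le)
  have "inj g" by (rule injI) (metis g_less linorder_neqE_linordered_idom order_less_irrefl)
  define h where "h = inv g"
  have hg [simp]: "h (g x) = x" and gh [simp]: "g (h x) = x" for x
    using \<open>inj g\<close> \<open>surj g\<close> by (auto simp: h_def surj_f_inv_f)
  have h_le: "h x \<le> h y \<longleftrightarrow> y \<le> x" for x y using g_le[of "h y" "h x"] by simp
  have g_cont: "continuous_on UNIV g"
    by (rule strict_antimono_surj_continuous) fact+
  have "continuous_on UNIV h"
  proof (rule strict_antimono_surj_continuous)
    show "strict_antimono_on UNIV h"
      by (rule monotone_onI) (metis h_le not_le)
    show "surj h" by (metis hg surjI)
  qed
  \<comment> \<open>Since \<open>g (c 1) = a\<close>, applying \<open>g\<close> again gives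
    \<open>g a = F (c 1)\<close>. Hence \<open>g\<close> maps \<open>{a..c 1}\<close> into
    \<open>{a..F (c 1)}\<close>, the domain of the inverse branch \<open>J\<close> below.\<close>
  have ga: "g a = F (c 1)" using g(3)[of "c 1"] g(4) order by simp
  have g_range: "g x \<in> {a..F (c 1)}" if "x \<in> {a..c 1}" for x
    using g_le[of "c 1" x] g_le[of x a] that ga g(4) by auto
  have ha: "h a = c 1" and hF: "h (F (c 1)) = a"
    using hg[of "c 1"] hg[of a] by (simp_all only: g(4) ga)
  have h_range: "h x \<in> {a..c 1}" if "x \<in> {a..F (c 1)}" for x
    using h_le[of x a] h_le[of "F (c 1)" x] that ha hF by simp
  have Fc1: "a < F (c 1)" "F (c 1) < c 1" using F_mono[of a "c 1"] order assms by auto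

  have cont12: "continuous_on {c 1..c 2} F"
    using cont by (rule continuous_on_subset) (use order in auto)
  have F_image: "F ` {c 1..c 2} = {a..F (c 1)}"
  proof
    have "strict_mono_on {c 1..c 2} F \<or> strict_antimono_on {c 1..c 2} F"
      using injective_eq_monotone_map[OF _ cont12] inj by (auto simp: is_interval_convex_1)
    \<comment> \<open>\<open>F (c 2) = a\<close> lies below \<open>F (c 1)\<close>, so
      \<open>F\<close> decreases on this lap and covers \<open>{a..F (c 1)}\<close> exactly.\<close>
    moreover have "\<not> strict_mono_on {c 1..c 2} F"
      using strict_mono_onD[of "{c 1..c 2}" F "c 1" "c 2"] order Fc1 assms by auto
    ultimately have anti: "strict_antimono_on {c 1..c 2} F" by blast
    have anti_le: "F y \<le> F x" if "x \<in> {c 1..c 2}" "y \<in> {c 1..c 2}" "x \<le> y" for x y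
      using monotone_onD[OF anti that(1,2)] that(3) by (cases "x = y") auto
    have "F x \<le> F (c 1) \<and> F (c 2) \<le> F x" if "x \<in> {c 1..c 2}" for x
      using anti_le[of "c 1" x] anti_le[of x "c 2"] that by simp
    then show "F ` {c 1..c 2} \<subseteq> {a..F (c 1)}" using assms by auto
    show "{a..F (c 1)} \<subseteq> F ` {c 1..c 2}"
      using IVT2'[of F "c 2" _ "c 1"] cont12 order assms by force
  qed
  define J where "J = inv_into {c 1..c 2} F"
  have JF: "J (F x) = x" if "x \<in> {c 1..c 2}" for x using that inj by (simp add: J_def)
  have FJ: "F (J y) = y" "J y \<in> {c 1..c 2}" if "y \<in> {a..F (c 1)}" for y
    using that unfolding J_def F_image[symmetric] by (rule f_inv_into_f, rule inv_into_into)
  have J_cont: "continuous_on {a..F (c 1)} J"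
    unfolding F_image[symmetric] by (rule continuous_on_inv[OF cont12]) (use JF in auto)

  \<comment> \<open>The branches agree at the joints: at \<open>c 1\<close> both
    \<open>g (c 1)\<close> and \<open>h (F (c 1))\<close> equal \<open>a\<close>; at
    \<open>c 2\<close> both \<open>h a\<close> and \<open>J (g a) = J (F (c 1))\<close> equal
    \<open>c 1\<close>. On the last piece \<open>J\<close> inverts \<open>F\<close>, and
    \<open>h (g (F x))\<close> returns \<open>F x\<close>.\<close>
  define f where "f x = (if x \<le> c 1 then g x else if x \<le> c 2 then h (F x) else J (g (F x)))" for x
  have f1: "f x = g x" if "x \<in> {a..c 1}" for x using that by (simp add: f_def)
  have f2: "f x = h (F x)" if "x \<in> {c 1..c 2}" for x
    using that hF g(4) by (cases "x = c 1") (auto simp: f_def)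
  have f3: "f x = J (g (F x))" if "x \<in> {c 2..b}" for x
  proof (cases "x = c 2")
    case True
    then show ?thesis using order ha ga JF[of "c 1"] assms(5,15) by (simp add: f_def)
  next
    case False
    then show ?thesis using that order by (simp add: f_def)
  qed
  have I: "{a..b} = {a..c 1} \<union> ({c 1..c 2} \<union> {c 2..b})" using order by auto
  \<comment> \<open>These ranges decide which branch acts in the second application of
    \<open>f\<close>: the first one up to \<open>c 2\<close>, the middle one beyond it.\<close>
  have f_range1: "f x \<in> {a..c 1}" if "x \<in> {a..c 2}" for x
  proof (cases "x \<le> c 1")
    case True
    then show ?thesis using f1[of x] g_range[of x] that Fc1 by auto
  next
    case False
    then have "x \<in> {c 1..c 2}" using that by auto
    then have "F x \<in> {a..F (c 1)}" using F_image by blast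
    then show ?thesis using f2[OF \<open>x \<in> {c 1..c 2}\<close>] h_range by simp
  qed
  have f_range2: "f x \<in> {c 1..c 2}" if "x \<in> {c 2..b}" for x
    using f3[OF that] FJ(2)[OF g_range[OF F_range]] that order by auto
  have f_range: "f x \<in> {a..b}" if "x \<in> {a..b}" for x
  proof (cases "x \<le> c 2")
    case True
    then have "f x \<in> {a..c 1}" using f_range1 that by simp
    then show ?thesis using order by simp
  next
    case False
    then have "f x \<in> {c 1..c 2}" using f_range2 that by simp
    then show ?thesis using order by simp
  qed
  have sq: "f (f x) = F x" if "x \<in> {a..b}" for x
  proof -
    consider "x \<in> {a..c 1}" | "x \<in> {c 1..c 2}" | "x \<in> {c 2..b}" using \<open>x \<in> {a..b}\<close> I by blast
    then show ?thesis
    proof cases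
      case 1
      then have "f x \<in> {a..c 1}" using f_range1[of x] order by auto
      then show ?thesis using 1 g(3) f1 by simp
    next
      case 2
      then have "f x \<in> {a..c 1}" using f_range1[of x] order by auto
      then show ?thesis using 2 f1 f2 by simp
    next
      case 3
      then show ?thesis
        using f2[OF f_range2[OF 3]] f3[OF 3] FJ(1)[OF g_range[OF F_range[OF that]]] by simp
    qed
  qed
  have f_cont: "continuous_on {a..b} f"
    unfolding I
  proof (intro continuous_on_closed_Un closed_Un closed_real_atLeastAtMost)
    show "continuous_on {a..c 1} f"
      using continuous_on_subset[OF g_cont subset_UNIV] by (rule continuous_on_eq) (simp add: f1)
    have "continuous_on {c 1..c 2} (\<lambda>x. h (F x))"
      using continuous_on_compose2[OF \<open>continuous_on UNIV h\<close> cont12] by simp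
    then show "continuous_on {c 1..c 2} f" by (rule continuous_on_eq) (simp add: f2)
    have "continuous_on {c 2..b} F"
      using cont by (rule continuous_on_subset) (use order in auto)
    then have "continuous_on {c 2..b} (\<lambda>x. g (F x))"
      using continuous_on_compose2[OF g_cont] by simp
    then have "continuous_on {c 2..b} (\<lambda>x. J (g (F x)))"
      by (rule continuous_on_compose2[OF J_cont]) (use g_range[OF F_range] order in auto)
    then show "continuous_on {c 2..b} f" by (rule continuous_on_eq) (simp add: f3)
  qed

  have "inj_on f {a..c 1}" using \<open>inj g\<close> f1 by (auto simp: inj_on_def inj_def)
  \<comment> \<open>Equal values of \<open>f\<close> give equal values of
    \<open>f (f x) = F x\<close>, so \<open>f\<close> is injective wherever \<open>F\<close> is and
    acquires no further forts.\<close>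
  have inj_F_f: "inj_on f (S \<inter> {a..b})" if "inj_on F (S \<inter> {a..b})" for S
    using that sq by (metis IntD2 inj_on_def)
  have sub: "forts a b f \<subseteq> forts a b F"
    unfolding subset_iff fort_iff_not_locally_injective[OF f_cont] fort_iff_not_locally_injective[OF cont]
    using inj_F_f by blast
  have "c 2 \<notin> forts a b f"
  proof -
    have "inj_on f {c 1..c 3}"
    proof (rule linorder_inj_onI')
      fix x y assume xy: "x \<in> {c 1..c 3}" "y \<in> {c 1..c 3}" "x < y"
      then have ab: "x \<in> {a..b}" "y \<in> {a..b}" using order by auto
      show "f x \<noteq> f y"
      proof
        assume eq: "f x = f y"
        then have "F x = F y" using sq ab by metis
        consider "y \<le> c 2" | "c 2 \<le> x" | "x < c 2" "c 2 < y" by linarith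
        then show False
        proof cases
          case 3
          \<comment> \<open>\<open>f\<close> is at most \<open>c 1\<close> left of
            \<open>c 2\<close> and at least \<open>c 1\<close> right of it, so a common value must
            be \<open>c 1\<close>; then \<open>F x = f (c 1) = a = F (c 2)\<close>.\<close>
          have "f x = c 1" using f_range1[of x] f_range2[of y] eq 3 ab by auto
          then have "F x = F (c 2)" using sq[OF ab(1)] f1[of "c 1"] g(4) order assms by simp
          then show False using inj_onD[OF inj(1), of x "c 2"] 3 xy by simp
        next
          case 1
          then show False using inj_onD[OF inj(1) \<open>F x = F y\<close>] xy by simp
        next
          case 2
          then show False using inj_onD[OF inj(2) \<open>F x = F y\<close>] xy by simp
        qed
      qed
    qed
    moreover have "ball (c 2) (min (c 2 - c 1) (c 3 - c 2)) \<inter> {a..b} \<subseteq> {c 1..c 3}"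
      by (auto simp: dist_real_def)
    moreover have "min (c 2 - c 1) (c 3 - c 2) > 0" using order by simp
    ultimately show ?thesis
      unfolding fort_iff_not_locally_injective[OF f_cont] by (meson inj_on_subset)
  qed
  have "c 1 \<in> forts a b f"
  proof (rule ccontr)
    assume "c 1 \<notin> forts a b f"
    then obtain e where e: "e > 0" "inj_on f (ball (c 1) e \<inter> {a..b})"
      using order by (auto simp: fort_iff_not_locally_injective f_cont)
    define d where "d = min e (c 2 - c 1)"
    have "d > 0" using e order by (simp add: d_def)
    \<comment> \<open>Near \<open>c 1\<close> the values of \<open>f\<close> stay in
      \<open>{a..c 1}\<close>, where \<open>f\<close> is injective, so local injectivity of
      \<open>f\<close> would pass to \<open>f (f x) = F x\<close>.\<close>
    have "inj_on F (ball (c 1) d \<inter> {a..b})"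
    proof (rule inj_onI)
      fix x y assume xy: "x \<in> ball (c 1) d \<inter> {a..b}" "y \<in> ball (c 1) d \<inter> {a..b}" "F x = F y"
      then have "f (f x) = f (f y)" using sq by simp
      moreover have "f x \<in> {a..c 1}" "f y \<in> {a..c 1}"
        using xy f_range1[of x] f_range1[of y] by (auto simp: d_def dist_real_def)
      ultimately have "f x = f y" using \<open>inj_on f {a..c 1}\<close> by (meson inj_onD)
      then show "x = y" using e(2) xy by (auto simp: d_def inj_on_def)
    qed
    then show False using forts(1) \<open>d > 0\<close> by (auto simp: fort_iff_not_locally_injective cont)
  qed

  have n0: "num_forts a b (f ^^ 0) = 0"
  proof -
    have "x \<notin> forts a b id" for x
      using fort_iff_not_locally_injective[OF continuous_on_id, of x a b] gt_ex[of "0::real"]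
      by (simp add: id_def)
    then have "forts a b id = {}" by blast
    then show ?thesis by (simp add: num_forts_def)
  qed
  have n1: "0 < num_forts a b (f ^^ 1)" "num_forts a b (f ^^ 1) < num_forts a b F"
  proof -
    have "finite (forts a b f)" using sub fin by (rule finite_subset)
    then show "0 < num_forts a b (f ^^ 1)"
      using \<open>c 1 \<in> forts a b f\<close> by (auto simp: num_forts_def card_gt_0_iff)
    have "forts a b f \<subset> forts a b F" using sub forts(2) \<open>c 2 \<notin> forts a b f\<close> by blast
    then show "num_forts a b (f ^^ 1) < num_forts a b F"
      using fin by (simp add: num_forts_def psubset_card_mono)
  qed
  have n2: "num_forts a b (f ^^ 2) = num_forts a b F"
    unfolding num_forts_def by (rule arg_cong[where f = card], rule forts_cong)
      (simp add: sq numeral_2_eq_2)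
  have n3: "num_forts a b (f ^^ 3) = num_forts a b F"
  proof -
    have "forts a b (f ^^ 3) = forts a b (\<lambda>x. f (F x))"
      by (rule forts_cong) (simp add: sq numeral_3_eq_3)
    also have "\<dots> = forts a b F"
    proof -
      have "continuous_on {a..b} (\<lambda>x. f (F x))"
        by (rule continuous_on_compose2[OF f_cont cont]) (use F_range order in force)
      \<comment> \<open>The range of \<open>F\<close> lies in \<open>{a..c 1}\<close>, where
        \<open>f\<close> is injective, so applying \<open>f\<close> after \<open>F\<close>
        identifies no further points.\<close>
      moreover have "inj_on (\<lambda>x. f (F x)) (S \<inter> {a..b}) \<longleftrightarrow> inj_on F (S \<inter> {a..b})" for S
      proof -
        have "f (F x) = f (F y) \<longleftrightarrow> F x = F y" if "x \<in> {a..b}" "y \<in> {a..b}" for x y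
          using inj_on_eq_iff[OF \<open>inj_on f {a..c 1}\<close>] F_range that by blast
        then show ?thesis unfolding inj_on_def by blast
      qed
      ultimately show ?thesis
        by (simp add: set_eq_iff fort_iff_not_locally_injective cont)
    qed
    finally show ?thesis by (simp add: num_forts_def)
  qed
  have "height a b f = 2"
  proof -
    let ?P = "\<lambda>i. num_forts a b (f ^^ i) = num_forts a b (f ^^ Suc i)"
    have P2: "?P 2" using n2 n3 by (simp add: numeral_3_eq_3 numeral_2_eq_2)
    \<comment> \<open>The fort numbers satisfy \<open>0 < N(f) < N(F)\<close>, while
      \<open>f ^^ 2\<close> and \<open>f ^^ 3\<close> both have \<open>N(F)\<close> forts, so index
      2 is the first repetition.\<close>
    have "\<not> ?P 0" "\<not> ?P 1" using n0 n1 n2 by (simp_all add: numeral_2_eq_2)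
    then have "2 \<le> i" if "?P i" for i
      using that by (metis One_nat_def less_2_cases not_le)
    then have "(LEAST i. ?P i) = 2" using P2 by (intro Least_equality)
    moreover have "\<exists>i. ?P i" using P2 by (rule exI)
    ultimately show ?thesis unfolding height_def by (simp only: if_True numeral_eq_enat)
  qed
  moreover have "f \<in> PM a b"
    using f_cont f_range sub fin by (auto simp: PM_def intro: finite_subset)
  moreover have "strict_antimono_on {c 0..c 1} f"
    using g_less f1 assms(5) by (auto simp: monotone_on_def)
  ultimately show ?thesis using sq by blast
qed

end
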